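(* Let $\mathrm{stat}$ be a Mahonian statistic on set partitions, i.e. $\mathrm{lb}$ or any statistic equidistributed with $\mathrm{lb}$ on $\Pi_n$ for every $n$. Then $\mathrm{stat}$ exhibits the cyclic sieving phenomenon with respect to involutions on $\Pi_n$ having $b_n$ fixed points, where $\sum_{n\ge0}b_nt^n=1/(1-t-t^2)$ (so $b_n=1,1,2,3,5,\dots$).
   Context: $\Pi_n$ is the set of set partitions of $[n]$. For $\pi\in\Pi_n$, $\mathrm{lb}(\pi)=\#\{(B_1,B_2,k):B_1,B_2\text{ blocks of }\pi,\ k\in B_1,\ \min B_1<\min B_2<k\}$. Cyclic sieving for involutions: for an involution $\phi$ on a finite set $X$ and polynomial $f$, $(X,\{\mathrm{id},\phi\},f)$ exhibits the CSP iff $f(1)=|X|$ and $f(-1)$ equals the number of fixed points of $\phi$; a statistic exhibits the CSP with respect to involutions having $b_n$ fixed points if for every $n\ge0$ and every involution $\phi$ of $\Pi_n$ with exactly $b_n$ fixed points, $(\Pi_n,\{\mathrm{id},\phi\},\sum_{\pi\in\Pi_n}q^{\mathrm{stat}(\pi)})$ exhibits the CSP. *)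

theory Defs
  imports
    "HOL-Library.Disjoint_Sets"
    "HOL-Computational_Algebra.Computational_Algebra"
begin

definition set_partitions :: "nat \<Rightarrow> nat set set set" where
  "set_partitions n = {P. partition_on {1..n} P}"

definition lb :: "nat set set \<Rightarrow> nat" where
  "lb P = card {(B1, B2, k). B1 \<in> P \<and> B2 \<in> P \<and> k \<in> B1 \<and> Min B1 < Min B2 \<and> Min B2 < k}"

text \<open>
  The sets \<^term>\<open>set_partitions n\<close> are pairwise disjoint for different \<^term>\<open>n\<close> (the union of the
  blocks determines \<^term>\<open>n\<close>), so one function on sets of blocks represents a statistic on all of
  them at once.
\<close>

definition mahonian :: "(nat set set \<Rightarrow> nat) \<Rightarrow> bool" where
  "mahonian stat \<longleftrightarrow>
     (\<forall>n k. card {P \<in> set_partitions n. stat P = k} = card {P \<in> set_partitions n. lb P = k})"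

definition involution_on :: "'a set \<Rightarrow> ('a \<Rightarrow> 'a) \<Rightarrow> bool" where
  "involution_on X \<phi> \<longleftrightarrow> (\<forall>x\<in>X. \<phi> x \<in> X \<and> \<phi> (\<phi> x) = x)"

definition fixed_points_on :: "'a set \<Rightarrow> ('a \<Rightarrow> 'a) \<Rightarrow> 'a set" where
  "fixed_points_on X \<phi> = {x \<in> X. \<phi> x = x}"

text \<open>Cyclic sieving for the triple of \<open>X\<close>, the group \<open>{id, \<phi>}\<close> and the polynomial \<open>f\<close>.\<close>

definition exhibits_CSP :: "'a set \<Rightarrow> ('a \<Rightarrow> 'a) \<Rightarrow> int poly \<Rightarrow> bool" where
  "exhibits_CSP X \<phi> f \<longleftrightarrow>
     poly f 1 = int (card X) \<and> poly f (-1) = int (card (fixed_points_on X \<phi>))"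

definition gen_poly :: "(nat set set \<Rightarrow> nat) \<Rightarrow> nat \<Rightarrow> int poly" where
  "gen_poly stat n = (\<Sum>P\<in>set_partitions n. monom 1 (stat P))"

definition stat_exhibits_CSP :: "(nat set set \<Rightarrow> nat) \<Rightarrow> (nat \<Rightarrow> nat) \<Rightarrow> bool" where
  "stat_exhibits_CSP stat b \<longleftrightarrow>
     (\<forall>n \<phi>. involution_on (set_partitions n) \<phi> \<longrightarrow>
        card (fixed_points_on (set_partitions n) \<phi>) = b n \<longrightarrow>
        exhibits_CSP (set_partitions n) \<phi> (gen_poly stat n))"

end

theory Submission imports Defs begin

text \<open>
  A partition of \<open>{1..n+1}\<close> arises uniquely from a partition of \<open>{1..n}\<close> with \<open>m\<close> blocks by making
  \<open>n + 1\<close> a new block, which leaves \<open>lb\<close> unchanged, or by adding \<open>n + 1\<close> to a block, which raises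
  \<open>lb\<close> by the number of blocks with a larger minimum. At \<open>q = -1\<close> the \<open>m\<close> choices of the second kind
  contribute \<open>1 + q + \<dots> + q\<^sup>m\<^sup>-\<^sup>1\<close>, which is \<open>1\<close> for odd \<open>m\<close> and \<open>0\<close> for even \<open>m\<close>. Hence only the parity
  of the number of blocks matters, and two such steps give the Fibonacci recurrence.
\<close>

section \<open>Partitions built by inserting one new point\<close>

definition insert_into :: "'a \<Rightarrow> 'a set set \<Rightarrow> 'a set \<Rightarrow> 'a set set" where
  "insert_into x P C = insert (insert x C) (P - {C})"

lemma insert_into_eq_image:
  assumes "C \<in> P"
  shows "insert_into x P C = (\<lambda>B. if B = C then insert x B else B) ` P"
  using assms by (auto simp: insert_into_def)

text \<open>The extra choice \<open>C = {}\<close> encodes opening a new block: \<open>{}\<close> is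
  never a block of \<open>P\<close>, so \<open>insert_into x P {}\<close> is \<open>P\<close> with
  \<open>{x}\<close> added. Both kinds of insertion thus share one formula.\<close>

lemma partition_on_insert_into:
  assumes P: "partition_on A P" and x: "x \<notin> A" and C: "C \<in> insert {} P"
  shows "partition_on (insert x A) (insert_into x P C)"
proof (rule partition_onI)
  show "\<Union> (insert_into x P C) = insert x A"
    using partition_onD1[OF P] C by (auto simp: insert_into_def)
next
  show "{} \<notin> insert_into x P C"
    using partition_onD3[OF P] by (auto simp: insert_into_def)
next
  fix p p' assume "p \<in> insert_into x P C" "p' \<in> insert_into x P C" "p \<noteq> p'"
  moreover have "\<And>B B'. B \<in> P \<Longrightarrow> B' \<in> P \<Longrightarrow> B \<noteq> B' \<Longrightarrow> B \<inter> B' = {}"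
    using partition_onD2[OF P] by (auto simp: disjoint_def)
  moreover have "\<And>B. B \<in> P \<Longrightarrow> x \<notin> B"
    using partition_onD1[OF P] x by blast
  ultimately show "disjnt p p'"
    using C unfolding insert_into_def disjnt_def by blast
qed

lemma ex_insert_into:
  assumes Q: "partition_on (insert x A) Q" and x: "x \<notin> A"
  shows "\<exists>P C. partition_on A P \<and> C \<in> insert {} P \<and> Q = insert_into x P C"
proof -
  have disj: "\<And>B B'. B \<in> Q \<Longrightarrow> B' \<in> Q \<Longrightarrow> B \<noteq> B' \<Longrightarrow> B \<inter> B' = {}"
    using partition_onD2[OF Q] by (auto simp: disjoint_def)
  obtain D where D: "D \<in> Q" "x \<in> D"
    using partition_onD1[OF Q] by blast
  define C where "C = D - {x}"
  \<comment> \<open>Deleting \<open>x\<close> from its block \<open>D\<close> leaves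
    \<open>C\<close>, which is kept as a block unless \<open>D\<close> was the singleton
    \<open>{x}\<close>.\<close>
  define P where "P = (Q - {D}) \<union> ({C} - {{}})"
  have xn: "x \<notin> B" if "B \<in> Q - {D}" for B
    using disj[of B D] D that by auto
  have un: "\<Union> Q = insert x A"
    using partition_onD1[OF Q] by simp
  have ne: "{} \<notin> Q" using partition_onD3[OF Q] .
  have "\<Union> P = \<Union> (Q - {D}) \<union> (D - {x})"
    unfolding P_def C_def by auto
  also have "\<dots> = \<Union> Q - {x}" using xn D by auto
  finally have UP: "\<Union> P = A" using un x by auto
  have "partition_on A P"
  proof (rule partition_onI)
    show "\<Union> P = A" by (rule UP)
  next
    show "{} \<notin> P" using ne by (auto simp: P_def)
  next
    fix p p' assume "p \<in> P" "p' \<in> P" "p \<noteq> p'"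
    moreover have "B \<inter> C = {}" if "B \<in> Q - {D}" for B
      using disj[of B D] D that by (auto simp: C_def)
    ultimately show "disjnt p p'"
      using disj unfolding P_def disjnt_def by blast
  qed
  moreover have "C \<in> insert {} P" by (auto simp: P_def)
  moreover have "Q = insert_into x P C"
  proof -
    have "insert x C = D" using D by (auto simp: C_def)
    \<comment> \<open>Otherwise removing \<open>C\<close> from \<open>P\<close> would also delete an
      old block of \<open>Q\<close>.\<close>
    moreover have "C \<notin> Q - {D}"
    proof
      assume "C \<in> Q - {D}"
      then have "C \<inter> D = {}" "C \<noteq> {}" using disj[of C D] D ne by auto
      then show False by (auto simp: C_def)
    qed
    then have "P - {C} = Q - {D}" by (auto simp: P_def)
    ultimately show ?thesis using D by (auto simp: insert_into_def)
  qed
  ultimately show ?thesis by blast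
qed

text \<open>The block containing \<open>x\<close> must be \<open>insert x C\<close>, which
  determines \<open>C\<close>. The remaining blocks are \<open>P - {C}\<close>, and putting
  \<open>C\<close> back, if it is nonempty, recovers \<open>P\<close>.\<close>

lemma insert_into_inject:
  assumes P: "partition_on A P" and P': "partition_on A P'" and x: "x \<notin> A"
    and C: "C \<in> insert {} P" and C': "C' \<in> insert {} P'"
    and eq: "insert_into x P C = insert_into x P' C'"
  shows "P = P' \<and> C = C'"
proof -
  have xP: "\<And>B. B \<in> P \<Longrightarrow> x \<notin> B" and xP': "\<And>B. B \<in> P' \<Longrightarrow> x \<notin> B"
    using partition_onD1[OF P] partition_onD1[OF P'] x by blast+
  have ne: "{} \<notin> P" "{} \<notin> P'"
    using partition_onD3[OF P] partition_onD3[OF P'] .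
  have "insert x C \<in> insert_into x P' C'"
    unfolding eq[symmetric] by (simp add: insert_into_def)
  then have "insert x C = insert x C'"
    using xP' by (auto simp: insert_into_def)
  moreover have "x \<notin> C" "x \<notin> C'" using C C' xP xP' by auto
  ultimately have CC: "C = C'" by (metis insert_ident)
  have "insert x C \<notin> P - {C}" "insert x C \<notin> P' - {C}" using xP xP' by auto
  then have PP: "P - {C} = P' - {C}"
    using eq unfolding insert_into_def CC[symmetric] by (metis insert_ident)
  have "P = P'"
  proof (cases "C = {}")
    case True
    then show ?thesis using PP ne by simp
  next
    case False
    then have "C \<in> P" "C \<in> P'" using C C' CC by auto
    then show ?thesis using PP by (metis insert_Diff)
  qed
  with CC show ?thesis by simp
qed

text \<open>Insertion is a bijection from the pairs \<open>(P, C)\<close> with \<open>C\<close> in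
  \<open>insert {} P\<close>. The term for \<open>C = {}\<close> is split off as the singleton
  case.\<close>

lemma sum_partition_on_insert:
  fixes g :: "'a set set \<Rightarrow> 'b::comm_monoid_add"
  assumes A: "finite A" and x: "x \<notin> A"
  shows "(\<Sum>Q | partition_on (insert x A) Q. g Q)
    = (\<Sum>P | partition_on A P. g (insert {x} P) + (\<Sum>C\<in>P. g (insert_into x P C)))"
proof -
  let ?S = "SIGMA P:{P. partition_on A P}. insert {} P"
  have "bij_betw (\<lambda>(P, C). insert_into x P C) ?S {Q. partition_on (insert x A) Q}"
    unfolding bij_betw_def
  proof
    show "inj_on (\<lambda>(P, C). insert_into x P C) ?S"
    proof (rule inj_onI, clarsimp simp del: insert_iff)
      fix P C P' C'
      assume "partition_on A P" "C \<in> insert {} P" "partition_on A P'" "C' \<in> insert {} P'"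
        and "insert_into x P C = insert_into x P' C'"
      then show "P = P' \<and> C = C'" using insert_into_inject[OF _ _ x] by metis
    qed
    show "(\<lambda>(P, C). insert_into x P C) ` ?S = {Q. partition_on (insert x A) Q}"
    proof (intro equalityI subsetI)
      fix Q assume "Q \<in> (\<lambda>(P, C). insert_into x P C) ` ?S"
      then show "Q \<in> {Q. partition_on (insert x A) Q}"
        using partition_on_insert_into[OF _ x] by auto
    next
      fix Q assume "Q \<in> {Q. partition_on (insert x A) Q}"
      then obtain P C where "partition_on A P" "C \<in> insert {} P" "Q = insert_into x P C"
        using ex_insert_into[OF _ x] by blast
      then show "Q \<in> (\<lambda>(P, C). insert_into x P C) ` ?S" by force
    qed
  qed
  from sum.reindex_bij_betw[OF this, of g]
  have "(\<Sum>Q | partition_on (insert x A) Q. g Q) = (\<Sum>(P, C)\<in>?S. g (insert_into x P C))"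
    by (simp add: case_prod_unfold)
  also have "\<dots> = (\<Sum>P | partition_on A P. \<Sum>C\<in>insert {} P. g (insert_into x P C))"
    using finitely_many_partition_on[OF A] finite_elements[OF A]
    by (subst sum.Sigma) auto
  also have "\<dots> = (\<Sum>P | partition_on A P. g (insert {x} P) + (\<Sum>C\<in>P. g (insert_into x P C)))"
  proof (rule sum.cong[OF refl])
    fix P assume "P \<in> {P. partition_on A P}"
    then have P: "finite P" "{} \<notin> P"
      using finite_elements[OF A] partition_onD3 by auto
    then have "insert_into x P {} = insert {x} P" by (simp add: insert_into_def)
    then show "(\<Sum>C\<in>insert {} P. g (insert_into x P C))
      = g (insert {x} P) + (\<Sum>C\<in>P. g (insert_into x P C))"
      using P by simp
  qed
  finally show ?thesis .
qed

section \<open>Effect of inserting a largest point on \<open>lb\<close>\<close>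

lemma lb_eq_sum:
  assumes "finite P" and "\<And>B. B \<in> P \<Longrightarrow> finite B"
  shows "lb P = (\<Sum>B1\<in>P. \<Sum>B2\<in>P. card {k \<in> B1. Min B1 < Min B2 \<and> Min B2 < k})"
proof -
  have "{(B1, B2, k). B1 \<in> P \<and> B2 \<in> P \<and> k \<in> B1 \<and> Min B1 < Min B2 \<and> Min B2 < k}
    = (SIGMA B1:P. SIGMA B2:P. {k \<in> B1. Min B1 < Min B2 \<and> Min B2 < k})"
    by auto
  then show ?thesis
    using assms by (simp add: lb_def card_SigmaI)
qed

text \<open>No counted triple involves \<open>{x}\<close>: as second block it would need an entry
  \<open>k > x\<close>, and as first block it would need another minimum above
  \<open>x\<close>.\<close>

lemma lb_insert_singleton:
  assumes fin: "finite P" "\<And>B. B \<in> P \<Longrightarrow> finite B" and ne: "{} \<notin> P"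
    and x: "\<And>B k. B \<in> P \<Longrightarrow> k \<in> B \<Longrightarrow> k < x"
  shows "lb (insert {x} P) = lb P"
proof -
  have "Min B < x" if "B \<in> P" for B
    using that fin ne x by (metis Min_in)
  then have "B1 \<in> insert {x} P \<and> B2 \<in> insert {x} P \<and> k \<in> B1 \<and> Min B1 < Min B2 \<and> Min B2 < k
    \<longleftrightarrow> B1 \<in> P \<and> B2 \<in> P \<and> k \<in> B1 \<and> Min B1 < Min B2 \<and> Min B2 < k" for B1 B2 k
    using x by (cases "B1 = {x}"; cases "B2 = {x}") (force dest: less_asym)+
  then have "{(B1, B2, k). B1 \<in> insert {x} P \<and> B2 \<in> insert {x} P \<and> k \<in> B1 \<and> Min B1 < Min B2 \<and> Min B2 < k}
    = {(B1, B2, k). B1 \<in> P \<and> B2 \<in> P \<and> k \<in> B1 \<and> Min B1 < Min B2 \<and> Min B2 < k}"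
    by simp
  then show ?thesis by (simp add: lb_def)
qed

text \<open>A largest element changes no minimum, so the old triples survive. The new ones are
  \<open>(insert x C, B, x)\<close> with \<open>Min C < Min B\<close>, where
  \<open>Min B < x\<close> is automatic.\<close>

lemma lb_insert_into:
  assumes fin: "finite P" "\<And>B. B \<in> P \<Longrightarrow> finite B" and ne: "{} \<notin> P"
    and x: "\<And>B k. B \<in> P \<Longrightarrow> k \<in> B \<Longrightarrow> k < x" and C: "C \<in> P"
  shows "lb (insert_into x P C) = lb P + card {B \<in> P. Min C < Min B}"
proof -
  \<comment> \<open>\<open>\<phi>\<close> matches old blocks with new ones and preserves minima, so
    both values of \<open>lb\<close> become double sums over \<open>P\<close> that can be compared
    term by term.\<close>
  define \<phi> where "\<phi> = (\<lambda>B. if B = C then insert x B else B)"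
  define h :: "nat set \<Rightarrow> nat set \<Rightarrow> nat"
    where "h = (\<lambda>B1 B2. card {k \<in> B1. Min B1 < Min B2 \<and> Min B2 < k})"
  have xn: "x \<notin> B" if "B \<in> P" for B using x[OF that, of x] by auto
  have Min_less: "Min B < x" if "B \<in> P" for B
    using that fin ne x by (metis Min_in)
  have Min_\<phi>: "Min (\<phi> B) = Min B" if "B \<in> P" for B
  proof -
    have "finite B" "B \<noteq> {}" using that fin ne by auto
    then have "Min (insert x B) = Min B" using Min_less[OF that] by simp
    then show ?thesis by (auto simp: \<phi>_def)
  qed
  have inj: "inj_on \<phi> P"
    using xn C by (auto simp: inj_on_def \<phi>_def split: if_splits)
  have h_\<phi>: "h (\<phi> B1) (\<phi> B2) = h B1 B2 + (if B1 = C \<and> Min C < Min B2 then 1 else 0)"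
    if B: "B1 \<in> P" "B2 \<in> P" for B1 B2
  proof (cases "B1 = C \<and> Min C < Min B2")
    case True
    then have "{k \<in> \<phi> B1. Min (\<phi> B1) < Min (\<phi> B2) \<and> Min (\<phi> B2) < k}
      = insert x {k \<in> B1. Min B1 < Min B2 \<and> Min B2 < k}"
      unfolding Min_\<phi>[OF B(1)] Min_\<phi>[OF B(2)] using Min_less[OF B(2)] by (auto simp: \<phi>_def)
    then show ?thesis
      using True B xn fin by (simp add: h_def)
  next
    case False
    then have "{k \<in> \<phi> B1. Min (\<phi> B1) < Min (\<phi> B2) \<and> Min (\<phi> B2) < k}
      = {k \<in> B1. Min B1 < Min B2 \<and> Min B2 < k}"
      unfolding Min_\<phi>[OF B(1)] Min_\<phi>[OF B(2)] by (auto simp: \<phi>_def)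
    then show ?thesis
      using False by (auto simp: h_def)
  qed
  have "lb (insert_into x P C) = lb (\<phi> ` P)"
    by (simp add: insert_into_eq_image[OF C] \<phi>_def)
  also have "\<dots> = (\<Sum>B1\<in>\<phi> ` P. \<Sum>B2\<in>\<phi> ` P. h B1 B2)"
    unfolding h_def by (rule lb_eq_sum) (use fin in \<open>auto simp: \<phi>_def\<close>)
  also have "\<dots> = (\<Sum>B1\<in>P. \<Sum>B2\<in>P. h (\<phi> B1) (\<phi> B2))"
    by (simp add: sum.reindex[OF inj])
  also have "\<dots> = (\<Sum>B1\<in>P. \<Sum>B2\<in>P. h B1 B2)
      + (\<Sum>B1\<in>P. \<Sum>B2\<in>P. if B1 = C \<and> Min C < Min B2 then 1 else 0)"
    by (simp add: h_\<phi> sum.distrib)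
  also have "(\<Sum>B1\<in>P. \<Sum>B2\<in>P. h B1 B2) = lb P"
    unfolding h_def by (rule lb_eq_sum[symmetric]) (use fin in auto)
  also have "(\<Sum>B1\<in>P. \<Sum>B2\<in>P. if B1 = C \<and> Min C < Min B2 then 1 else 0)
      = (\<Sum>B1\<in>P. if B1 = C then (\<Sum>B2\<in>P. if Min C < Min B2 then 1 else 0) else (0::nat))"
    by (intro sum.cong) auto
  also have "\<dots> = card {B \<in> P. Min C < Min B}"
    using fin C by (simp add: sum.inter_filter[symmetric])
  finally show ?thesis .
qed

section \<open>One insertion step for the sum at q = -1\<close>

text \<open>The exponents run through 0, ..., \<open>card M - 1\<close>, so this is an alternating
  sum of ones. In the induction a new minimum \<open>b\<close> contributes
  \<open>(-1) ^ card A\<close> and leaves the other exponents unchanged.\<close>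

lemma sum_neg_one_power_card_greater:
  fixes M :: "'a::linorder set"
  assumes "finite M"
  shows "(\<Sum>m\<in>M. (-1::int) ^ card {x \<in> M. m < x}) = of_bool (odd (card M))"
  using assms
proof (induction rule: finite_linorder_min_induct)
  case empty
  then show ?case by simp
next
  case (insert b A)
  have "{x \<in> insert b A. b < x} = A" using insert.hyps by auto
  moreover have "{x \<in> insert b A. m < x} = {x \<in> A. m < x}" if "m \<in> A" for m
    using insert.hyps that by (auto dest: less_asym)
  moreover have "b \<notin> A" using insert.hyps by auto
  ultimately show ?case
    using insert.hyps insert.IH by simp
qed

lemma inj_on_Min_partition:
  assumes "partition_on A P" and "finite A"
  shows "inj_on Min P"
proof (rule inj_onI)
  fix B B' assume B: "B \<in> P" "B' \<in> P" and eq: "Min B = Min B'"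
  have "finite B" "finite B'" "B \<noteq> {}" "B' \<noteq> {}"
    using B partition_onD1[OF assms(1)] partition_onD3[OF assms(1)] assms(2)
    by (auto intro: finite_subset)
  then have "Min B \<in> B \<inter> B'" using eq by (metis IntI Min_in)
  then show "B = B'"
    using partition_onD2[OF assms(1)] B by (auto simp: disjoint_def)
qed

lemma finite_set_partitions: "finite (set_partitions n)"
  unfolding set_partitions_def by (rule finitely_many_partition_on) simp

text \<open>The arbitrary weight \<open>u\<close> of the number of blocks allows the step to be iterated.\<close>

lemma signed_sum_set_partitions_Suc:
  fixes u :: "nat \<Rightarrow> int"
  shows "(\<Sum>P\<in>set_partitions (Suc n). u (card P) * (-1) ^ lb P)
    = (\<Sum>P\<in>set_partitions n. (u (Suc (card P)) + of_bool (odd (card P)) * u (card P)) * (-1) ^ lb P)"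
proof -
  let ?x = "Suc n" and ?g = "\<lambda>P. u (card P) * (-1) ^ lb P"
  have "(\<Sum>P\<in>set_partitions (Suc n). ?g P) = (\<Sum>P | partition_on (insert ?x {1..n}) P. ?g P)"
    by (simp add: set_partitions_def atLeastAtMostSuc_conv)
  also have "\<dots> = (\<Sum>P\<in>set_partitions n. ?g (insert {?x} P) + (\<Sum>C\<in>P. ?g (insert_into ?x P C)))"
    unfolding set_partitions_def by (rule sum_partition_on_insert) auto
  also have "\<dots> = (\<Sum>P\<in>set_partitions n.
      (u (Suc (card P)) + of_bool (odd (card P)) * u (card P)) * (-1) ^ lb P)"
  proof (rule sum.cong[OF refl])
    fix P assume "P \<in> set_partitions n"
    then have P: "partition_on {1..n} P" by (simp add: set_partitions_def)
    have sub: "B \<subseteq> {1..n}" if "B \<in> P" for B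
      using partition_onD1[OF P] that by blast
    have fin: "finite P" using finite_elements[OF _ P] by simp
    have finB: "finite B" if "B \<in> P" for B
      using sub[OF that] by (rule finite_subset) simp
    have ne: "{} \<notin> P" using partition_onD3[OF P] .
    have less: "k < ?x" if "B \<in> P" "k \<in> B" for B k
      using sub[OF that(1)] that(2) by auto
    have xn: "?x \<notin> B" if "B \<in> P" for B using less[OF that, of ?x] by auto
    have new: "?g (insert {?x} P) = u (Suc (card P)) * (-1) ^ lb P"
    proof -
      have "lb (insert {?x} P) = lb P"
        using fin finB ne less by (rule lb_insert_singleton)
      moreover have "{?x} \<notin> P" using xn by auto
      ultimately show ?thesis using fin by simp
    qed
    have card_into: "card (insert_into ?x P C) = card P" if "C \<in> P" for C
      unfolding insert_into_eq_image[OF that]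
      by (rule card_image) (use xn in \<open>auto simp: inj_on_def split: if_splits\<close>)
    have "(\<Sum>C\<in>P. ?g (insert_into ?x P C))
      = (\<Sum>C\<in>P. u (card P) * (-1) ^ lb P * (-1) ^ card {B \<in> P. Min C < Min B})"
    proof (rule sum.cong[OF refl])
      fix C assume C: "C \<in> P"
      have "lb (insert_into ?x P C) = lb P + card {B \<in> P. Min C < Min B}"
        using fin finB ne less C by (rule lb_insert_into)
      then show "?g (insert_into ?x P C)
        = u (card P) * (-1) ^ lb P * (-1) ^ card {B \<in> P. Min C < Min B}"
        by (simp add: card_into[OF C] power_add)
    qed
    also have "\<dots> = u (card P) * (-1) ^ lb P * (\<Sum>C\<in>P. (-1) ^ card {B \<in> P. Min C < Min B})"
      by (simp add: sum_distrib_left)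
    \<comment> \<open>Distinct blocks have distinct minima, so blocks can be replaced by their
      minima, which form a finite set of numbers.\<close>
    also have "(\<Sum>C\<in>P. (-1) ^ card {B \<in> P. Min C < Min B})
      = (\<Sum>m\<in>Min ` P. (-1::int) ^ card {x \<in> Min ` P. m < x})"
    proof -
      have inj: "inj_on Min P" using inj_on_Min_partition[OF P] by simp
      have "card {x \<in> Min ` P. m < x} = card {B \<in> P. m < Min B}" for m
      proof -
        have "{x \<in> Min ` P. m < x} = Min ` {B \<in> P. m < Min B}" by auto
        then show ?thesis
          by (simp add: card_image[OF inj_on_subset[OF inj]])
      qed
      then show ?thesis by (simp add: sum.reindex[OF inj])
    qed
    also have "\<dots> = of_bool (odd (card P))"
      using sum_neg_one_power_card_greater[of "Min ` P"] fin
        card_image[OF inj_on_Min_partition[OF P]] by simp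
    finally show "?g (insert {?x} P) + (\<Sum>C\<in>P. ?g (insert_into ?x P C))
      = (u (Suc (card P)) + of_bool (odd (card P)) * u (card P)) * (-1) ^ lb P"
      using new by (simp add: algebra_simps)
  qed
  finally show ?thesis .
qed

section \<open>The Fibonacci recurrence\<close>

lemma set_partitions_0: "set_partitions 0 = {{}}"
  by (simp add: set_partitions_def partition_on_empty)

lemma lb_empty: "lb {} = 0"
  using lb_eq_sum[of "{}"] by simp

lemma signed_sum_lb_0: "(\<Sum>P\<in>set_partitions 0. (-1::int) ^ lb P) = 1"
  by (simp add: set_partitions_0 lb_empty)

lemma signed_sum_lb_Suc_0: "(\<Sum>P\<in>set_partitions (Suc 0). (-1::int) ^ lb P) = 1"
  using signed_sum_set_partitions_Suc[of "\<lambda>_. 1" 0]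
  by (simp add: set_partitions_0 lb_empty)

lemma signed_sum_lb_Suc_Suc:
  "(\<Sum>P\<in>set_partitions (Suc (Suc n)). (-1::int) ^ lb P)
    = (\<Sum>P\<in>set_partitions (Suc n). (-1) ^ lb P) + (\<Sum>P\<in>set_partitions n. (-1) ^ lb P)"
proof -
  have "(\<Sum>P\<in>set_partitions (Suc (Suc n)). (-1::int) ^ lb P)
    = (\<Sum>P\<in>set_partitions (Suc n). (1 + of_bool (odd (card P))) * (-1) ^ lb P)"
    using signed_sum_set_partitions_Suc[of "\<lambda>_. 1" "Suc n"] by simp
  \<comment> \<open>With u(c) = 1 + [c odd], the new weight u(c+1) + [c odd] u(c) is 2 for even c
    and 3 for odd c, hence u(c) + 1. The part u(c) is the weight that one step down from
    \<open>Suc n\<close> produces.\<close>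
  also have "\<dots> = (\<Sum>P\<in>set_partitions n. (1 + of_bool (odd (card P))) * (-1) ^ lb P + (-1) ^ lb P)"
    using signed_sum_set_partitions_Suc[of "\<lambda>c. 1 + of_bool (odd c)" n]
    by (auto simp: algebra_simps intro!: sum.cong)
  also have "\<dots> = (\<Sum>P\<in>set_partitions (Suc n). (-1) ^ lb P) + (\<Sum>P\<in>set_partitions n. (-1) ^ lb P)"
    using signed_sum_set_partitions_Suc[of "\<lambda>_. 1" n] by (simp add: sum.distrib)
  finally show ?thesis .
qed

lemma fibonacci_of_fps:
  fixes b :: "nat \<Rightarrow> nat"
  assumes "Abs_fps (\<lambda>n. of_nat (b n) :: rat) = 1 / (1 - fps_X - fps_X ^ 2)"
  shows "b 0 = 1" "b (Suc 0) = 1" "b (Suc (Suc n)) = b (Suc n) + b n"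
proof -
  define F :: "rat fps" where "F = Abs_fps (\<lambda>n. of_nat (b n))"
  define D :: "rat fps" where "D = 1 - fps_X - fps_X ^ 2"
  \<comment> \<open>The nonzero constant term makes \<open>D\<close> a unit, so the quotient is a
    genuine inverse; the recurrence then follows by comparing coefficients in
    \<open>F * D = 1\<close>.\<close>
  have "fps_nth D 0 \<noteq> 0" by (simp add: D_def)
  then have "F * D = 1"
    using assms unfolding F_def[symmetric] D_def[symmetric]
    by (simp add: fps_divide_unit inverse_mult_eq_1)
  then have F: "F = 1 + fps_X * F + fps_X ^ 2 * F"
    by (simp add: D_def algebra_simps)
  have rec: "fps_nth F k = fps_nth (1 + fps_X * F + fps_X ^ 2 * F) k" for k
    using F by (rule arg_cong)
  have nth: "fps_nth F k = of_nat (b k)" for k by (simp add: F_def)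
  have "fps_nth F 0 = 1" using rec[of 0] by simp
  then show "b 0 = 1" using nth[of 0] by simp
  have "fps_nth F (Suc 0) = fps_nth F 0"
    using rec[of "Suc 0"] by (simp add: fps_X_power_mult_nth)
  with \<open>b 0 = 1\<close> show "b (Suc 0) = 1" unfolding nth by simp
  have "fps_nth F (Suc (Suc n)) = fps_nth F (Suc n) + fps_nth F n"
    using rec[of "Suc (Suc n)"] by (simp add: fps_X_power_mult_nth)
  then show "b (Suc (Suc n)) = b (Suc n) + b n"
    unfolding nth by (metis of_nat_add of_nat_eq_iff)
qed

lemma signed_sum_lb_eq_fibonacci:
  assumes "Abs_fps (\<lambda>n. of_nat (b n) :: rat) = 1 / (1 - fps_X - fps_X ^ 2)"
  shows "(\<Sum>P\<in>set_partitions n. (-1::int) ^ lb P) = int (b n)"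
proof (induction n rule: induct_nat_012)
  case 0
  then show ?case using signed_sum_lb_0 fibonacci_of_fps[OF assms] by simp
next
  case 1
  then show ?case using signed_sum_lb_Suc_0 fibonacci_of_fps[OF assms] by simp
next
  case (ge2 n)
  then show ?case using signed_sum_lb_Suc_Suc[of n] fibonacci_of_fps(3)[OF assms, of n] by simp
qed

section \<open>Transfer to equidistributed statistics\<close>

lemma sum_eq_sum_card_fibres:
  fixes h :: "'b \<Rightarrow> int"
  assumes "finite X" "finite K" "s ` X \<subseteq> K"
  shows "(\<Sum>x\<in>X. h (s x)) = (\<Sum>k\<in>K. int (card {x \<in> X. s x = k}) * h k)"
proof -
  have "(\<Sum>x\<in>X. h (s x)) = (\<Sum>k\<in>K. \<Sum>x | x \<in> X \<and> s x = k. h (s x))"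
    using sum.group[OF assms, of "\<lambda>x. h (s x)"] by simp
  also have "\<dots> = (\<Sum>k\<in>K. int (card {x \<in> X. s x = k}) * h k)"
    by (intro sum.cong) auto
  finally show ?thesis .
qed

lemma sum_mahonian:
  fixes h :: "nat \<Rightarrow> int"
  assumes "mahonian stat"
  shows "(\<Sum>P\<in>set_partitions n. h (stat P)) = (\<Sum>P\<in>set_partitions n. h (lb P))"
proof -
  \<comment> \<open>A common index set for both statistics; a value that one of them misses has an
    empty fibre and contributes 0.\<close>
  let ?K = "stat ` set_partitions n \<union> lb ` set_partitions n"
  have K: "finite ?K" using finite_set_partitions by simp
  show ?thesis
    using assms sum_eq_sum_card_fibres[OF finite_set_partitions K, of stat]
      sum_eq_sum_card_fibres[OF finite_set_partitions K, of lb]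
    by (simp add: mahonian_def)
qed

theorem theorem4p5:
  fixes stat :: "nat set set \<Rightarrow> nat" and b :: "nat \<Rightarrow> nat"
  assumes "mahonian stat"
    and "Abs_fps (\<lambda>n. of_nat (b n) :: rat) = 1 / (1 - fps_X - fps_X ^ 2)"
  shows "stat_exhibits_CSP stat b"
proof -
  have "poly (gen_poly stat n) 1 = int (card (set_partitions n))" for n
    by (simp add: gen_poly_def poly_sum poly_monom)
  \<comment> \<open>Evaluation at -1 gives the signed sum for \<open>stat\<close>, which
    equidistribution turns into the one for \<open>lb\<close>. The value \<open>b n\<close> is the
    prescribed number of fixed points.\<close>
  moreover have "poly (gen_poly stat n) (-1) = int (b n)" for n
    using sum_mahonian[OF assms(1), of "\<lambda>k. (-1) ^ k" n] signed_sum_lb_eq_fibonacci[OF assms(2), of n]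
    by (simp add: gen_poly_def poly_sum poly_monom)
  ultimately show ?thesis
    by (simp add: stat_exhibits_CSP_def exhibits_CSP_def)
qed

end
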